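(* Let $G^g,H^h$ be games with activeness such that $G^g$ is covered by $H^h$. Then $G^g=H^h$ if and only if both of the following hold: (b1) $\mathrm{type}(G^g)=\mathrm{type}(H^h)$; (b2) for every option $H'^{h'}$ of $H^h$ that is uncovered by $G^g$, there exists an option $H''^{h''}\in H'^{h'}$ with $H''^{h''}=G^g$.
   Context: Let $\mathcal{B}=\{0,1\}$. Define $\mathbb{I}_0=\{\emptyset\}\times\mathcal{B}$ and $\mathbb{I}_n=2^{\mathbb{I}_{n-1}}\times\mathcal{B}$ for $n\ge1$; a game with activeness is an element of $\mathbb{I}=\bigcup_{n\ge0}\mathbb{I}_n$. A pair $(G,g)$ is written $G^g$; the elements of $G$ are the options of $G^g$, and $g=1$ means active, $g=0$ inactive. The outcome $o$ is defined recursively: $o(G^g)=\mathscr{N}$ if $g=1$ and some option has outcome $\mathscr{P}$, and $o(G^g)=\mathscr{P}$ otherwise. The sum is $G^g+H^h=(\{G'^{g'}+H^h:G'^{g'}\in G^g\}\cup\{G^g+H'^{h'}:H'^{h'}\in H^h\})^{\max\{g,h\}}$. $G^g=H^h$ means $o(G^g+X^x)=o(H^h+X^x)$ for all games $X^x$. An option $G'^{g'}$ of $G^g$ is uncovered by $H^h$ if $G'^{g'}\neq H'^{h'}$ for all options $H'^{h'}$ of $H^h$; $G^g$ is covered by $H^h$ if $G^g$ has no option uncovered by $H^h$. $\mathrm{type}(G^g)$ is $0$ if $g=0$; $1_{\exists0}$ if $g=1$ and some option $G'^{g'}$ has $g'=0$; $1_{\forall1}$ if $g=1$ and every option $G'^{g'}$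 has $g'=1$. *)

theory Defs
  imports Main "HOL-Library.FSet"
begin

text \<open>
  The sets \<open>\<I>\<^sub>n\<close> are all finite, so a game is a hereditarily finite object: a finite set of
  games (the options) together with an activeness bit, where \<open>True\<close> stands for
  \<open>1\<close> (active) and \<open>False\<close> for \<open>0\<close> (inactive).  The theorem \<open>games_exhaust\<close>
  below relates the datatype to the layers \<open>\<I>\<^sub>n\<close>.
\<close>

datatype game = Game (opts: "game fset") (active: bool)

fun game_layer :: "nat \<Rightarrow> game set" where
  "game_layer 0 = {Game {||} b | b. True}"
| "game_layer (Suc n) = {Game S b | S b. fset S \<subseteq> game_layer n}"

lemma game_layer_Suc: "game_layer n \<subseteq> game_layer (Suc n)"
  by (induction n) force+

lemma game_layer_mono: "m \<le> n \<Longrightarrow> game_layer m \<subseteq> game_layer n"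
  using lift_Suc_mono_le[of game_layer, OF game_layer_Suc] by blast

theorem games_exhaust: "(\<Union>n. game_layer n) = UNIV"
proof -
  have "\<exists>n. G \<in> game_layer n" for G
  proof (induction G)
    case (Game S b)
    then obtain f where f: "\<And>X. X |\<in>| S \<Longrightarrow> X \<in> game_layer (f X)"
      by metis
    define n where "n = Max (insert 0 (f ` fset S))"
    have "f X \<le> n" if "X |\<in>| S" for X
      using that by (auto simp: n_def intro!: Max_ge)
    then have "fset S \<subseteq> game_layer n"
      using f game_layer_mono by blast
    then have "Game S b \<in> game_layer (Suc n)"
      by auto
    then show ?case ..
  qed
  then show ?thesis by auto
qed

lemma size_option: "X |\<in>| S \<Longrightarrow> size X < size (Game S b)"
  by (induction S) (auto simp: less_Suc_eq_le size_fset_overloaded_simps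
      intro!: member_le_sum le_SucI)

datatype outcome_class = \<N> | \<P>

function outcome :: "game \<Rightarrow> outcome_class" where
  "outcome (Game S g) = (if g \<and> (\<exists>G'\<in>fset S. outcome G' = \<P>) then \<N> else \<P>)"
  by pat_completeness auto
termination
  by (relation "measure size") (auto simp del: game.size dest: size_option)

function game_plus :: "game \<Rightarrow> game \<Rightarrow> game" (infixl "\<oplus>" 65) where
  "Game S g \<oplus> Game T h =
     Game ((\<lambda>G'. G' \<oplus> Game T h) |`| S |\<union>| (\<lambda>H'. Game S g \<oplus> H') |`| T) (max g h)"
  by pat_completeness auto
termination
  by (relation "measure (\<lambda>(G, H). size G + size H)")
     (auto simp del: game.size dest: size_option)

definition game_eq :: "game \<Rightarrow> game \<Rightarrow> bool" (infix "\<doteq>" 50) where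
  "G \<doteq> H \<longleftrightarrow> (\<forall>X. outcome (G \<oplus> X) = outcome (H \<oplus> X))"

definition is_option :: "game \<Rightarrow> game \<Rightarrow> bool" where
  "is_option G' G \<longleftrightarrow> G' |\<in>| opts G"

definition uncovered :: "game \<Rightarrow> game \<Rightarrow> game \<Rightarrow> bool" where
  "uncovered G' G H \<longleftrightarrow>
     is_option G' G \<and> (\<forall>H'. is_option H' H \<longrightarrow> \<not> G' \<doteq> H')"

definition covered_by :: "game \<Rightarrow> game \<Rightarrow> bool" where
  "covered_by G H \<longleftrightarrow> \<not> (\<exists>G'. uncovered G' G H)"

datatype game_type = Type0 | Type1_ex0 | Type1_all1

definition type_of :: "game \<Rightarrow> game_type" where
  "type_of G =
     (if \<not> active G then Type0
      else if \<exists>G'. is_option G' G \<and> \<not> active G' then Type1_ex0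
      else Type1_all1)"

end

theory Submission
  imports Defs
begin

text \<open>
  Call an active game whose sum with \<open>G\<close> is a \<open>\<P>\<close>-position a mate of \<open>G\<close>. An active game whose
  options include a mate of every option of \<open>G\<close> makes every move from \<open>G\<close> a losing one. It follows
  that every game has a mate, and that \<open>G\<close> has a mate which is not a mate of \<open>H\<close> unless they are equal.
  If an option \<open>H'\<close> of \<open>H\<close> violates (b2), then the mates separating \<open>H'\<close> from the options of \<open>G\<close> and
  \<open>G\<close> from the options of \<open>H'\<close> are together the options of a common mate of \<open>G\<close> and \<open>H'\<close>, which
  cannot be a mate of \<open>H\<close>. Conversely, (b2) says that the moves of \<open>H\<close> not available in \<open>G\<close> are
  reversible, and (b1) deals with the positions in which the reversing move cannot be played because
  play has already stopped.
\<close>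

lemma outcome_neq_N_iff: "outcome G \<noteq> \<N> \<longleftrightarrow> outcome G = \<P>"
  by (cases "outcome G") auto

lemma outcome_eqI: "(outcome G = \<N> \<longleftrightarrow> outcome H = \<N>) \<Longrightarrow> outcome G = outcome H"
  by (metis outcome_neq_N_iff)

lemma is_option_Game [simp]: "is_option X (Game S b) \<longleftrightarrow> X |\<in>| S"
  by (simp add: is_option_def)

lemma game_option_induct [case_names options]:
  assumes "\<And>G. (\<And>G'. is_option G' G \<Longrightarrow> P G') \<Longrightarrow> P G"
  shows "P G"
proof (induction G)
  case (Game S b)
  show ?case by (rule assms) (simp add: Game)
qed

lemma outcome_plus_eq_N_iff:
  "outcome (G \<oplus> X) = \<N> \<longleftrightarrow> (active G \<or> active X) \<and>
     ((\<exists>G'. is_option G' G \<and> outcome (G' \<oplus> X) = \<P>) \<or>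
      (\<exists>X'. is_option X' X \<and> outcome (G \<oplus> X') = \<P>))"
  by (cases G; cases X) (auto simp: max_def)

lemma outcome_plus_eq_P_iff:
  "outcome (G \<oplus> X) = \<P> \<longleftrightarrow> (active G \<or> active X \<longrightarrow>
     (\<forall>G'. is_option G' G \<longrightarrow> outcome (G' \<oplus> X) = \<N>) \<and>
     (\<forall>X'. is_option X' X \<longrightarrow> outcome (G \<oplus> X') = \<N>))"
  using outcome_plus_eq_N_iff[of G X] by (simp flip: outcome_neq_N_iff) blast

lemma outcome_plus_eq_N_left:
  assumes "active G \<or> active X" "is_option G' G" "outcome (G' \<oplus> X) = \<P>"
  shows "outcome (G \<oplus> X) = \<N>"
  using assms by (subst outcome_plus_eq_N_iff) blast

lemma outcome_plus_eq_N_right: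
  assumes "active G \<or> active X" "is_option X' X" "outcome (G \<oplus> X') = \<P>"
  shows "outcome (G \<oplus> X) = \<N>"
  using assms by (subst outcome_plus_eq_N_iff) blast

lemma outcome_plus_inactive_eq_P: "\<not> active G \<Longrightarrow> \<not> active X \<Longrightarrow> outcome (G \<oplus> X) = \<P>"
  by (subst outcome_plus_eq_P_iff) simp

lemma game_eq_sym [sym]: "G \<doteq> H \<Longrightarrow> H \<doteq> G"
  by (simp add: game_eq_def)

lemma game_eq_outcome_plus: "G \<doteq> H \<Longrightarrow> outcome (G \<oplus> X) = outcome (H \<oplus> X)"
  by (simp add: game_eq_def)

definition is_mate :: "game \<Rightarrow> game \<Rightarrow> bool" where
  "is_mate M G \<longleftrightarrow> active M \<and> outcome (G \<oplus> M) = \<P>"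

lemma game_eq_imp_is_mate_iff: "G \<doteq> H \<Longrightarrow> is_mate M G \<longleftrightarrow> is_mate M H"
  by (simp add: is_mate_def game_eq_outcome_plus)

lemma outcome_plus_mate_of_option_eq_N:
  assumes "is_option G' G" "is_mate M G'"
  shows "outcome (G \<oplus> M) = \<N>"
  using assms by (auto simp: is_mate_def intro: outcome_plus_eq_N_left)

lemma outcome_plus_Game_mates_eq_P:
  assumes mates: "\<And>G'. is_option G' G \<Longrightarrow> is_mate (m G') G'"
    and others: "\<And>T. T |\<in>| A \<Longrightarrow> outcome (G \<oplus> T) = \<N>"
    and act: "b \<or> (\<forall>G'. is_option G' G \<longrightarrow> active G')"
  shows "outcome (G \<oplus> Game (m |`| opts G |\<union>| A) b) = \<P>" (is "outcome (G \<oplus> ?X) = \<P>")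
proof -
  have "outcome (G' \<oplus> ?X) = \<N>" if G': "is_option G' G" for G'
  proof (rule outcome_plus_eq_N_right)
    show "active G' \<or> active ?X" using act G' by auto
    show "is_option (m G') ?X" using G' by (simp add: is_option_def)
    show "outcome (G' \<oplus> m G') = \<P>" using mates[OF G'] by (simp add: is_mate_def)
  qed
  moreover have "outcome (G \<oplus> X') = \<N>" if "is_option X' ?X" for X'
    using that mates others outcome_plus_mate_of_option_eq_N by (auto simp: is_option_def)
  ultimately show ?thesis
    by (subst outcome_plus_eq_P_iff) blast
qed

lemma ex_mate: "\<exists>M. is_mate M G"
proof (induction G rule: game_option_induct)
  case (options G)
  then obtain m where "\<And>G'. is_option G' G \<Longrightarrow> is_mate (m G') G'"
    by metis
  then have "outcome (G \<oplus> Game (m |`| opts G |\<union>| {||}) True) = \<P>"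
    by (intro outcome_plus_Game_mates_eq_P) auto
  then show ?case
    unfolding is_mate_def by (intro exI conjI) simp_all
qed

lemma ex_separating_mate_if_outcome_plus:
  assumes "outcome (G \<oplus> T) = \<N>" "outcome (H \<oplus> T) = \<P>"
  shows "\<exists>M. is_mate M G \<and> \<not> is_mate M H"
proof -
  obtain m where m: "\<And>G. is_mate (m G) G"
    using ex_mate by metis
  define M where "M = Game (m |`| opts G |\<union>| {|T|}) True"
  have "outcome (G \<oplus> M) = \<P>"
    unfolding M_def using m assms(1) by (intro outcome_plus_Game_mates_eq_P) auto
  moreover have "outcome (H \<oplus> M) = \<N>"
    using assms(2) by (intro outcome_plus_eq_N_right[of H M T]) (simp_all add: M_def)
  moreover have "active M"
    by (simp add: M_def)
  ultimately show ?thesis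
    by (auto simp: is_mate_def)
qed

lemma ex_separating_mate:
  assumes "\<not> G \<doteq> H"
  shows "\<exists>M. is_mate M G \<and> \<not> is_mate M H"
proof -
  obtain T where "outcome (G \<oplus> T) \<noteq> outcome (H \<oplus> T)"
    using assms by (auto simp: game_eq_def)
  then consider (G_wins) "outcome (G \<oplus> T) = \<N>" "outcome (H \<oplus> T) = \<P>"
    | (H_wins) "outcome (H \<oplus> T) = \<N>" "outcome (G \<oplus> T) = \<P>"
    using outcome_neq_N_iff by metis
  then show ?thesis
  proof cases
    case G_wins
    then show ?thesis by (rule ex_separating_mate_if_outcome_plus)
  next
    case H_wins
    then obtain U where "is_mate U H" "\<not> is_mate U G"
      using ex_separating_mate_if_outcome_plus by blast
    then have "outcome (G \<oplus> U) = \<N>" "outcome (H \<oplus> U) = \<P>"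
      using outcome_neq_N_iff by (auto simp: is_mate_def)
    then show ?thesis by (rule ex_separating_mate_if_outcome_plus)
  qed
qed

lemma ex_common_mate:
  assumes "\<And>G'. is_option G' G \<Longrightarrow> \<not> G' \<doteq> H" and "\<And>H'. is_option H' H \<Longrightarrow> \<not> H' \<doteq> G"
  shows "\<exists>M. is_mate M G \<and> is_mate M H"
proof -
  obtain sep where sep: "\<And>A B. \<not> A \<doteq> B \<Longrightarrow> is_mate (sep A B) A \<and> \<not> is_mate (sep A B) B"
    using ex_separating_mate by metis
  then have N: "outcome (B \<oplus> sep A B) = \<N>" if "\<not> A \<doteq> B" for A B
    using that outcome_neq_N_iff by (auto simp: is_mate_def)
  define M where
    "M = Game ((\<lambda>G'. sep G' H) |`| opts G |\<union>| (\<lambda>H'. sep H' G) |`| opts H) True"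
  have "outcome (G \<oplus> M) = \<P>"
    unfolding M_def using sep N assms
    by (intro outcome_plus_Game_mates_eq_P) (auto simp: is_option_def)
  moreover have "outcome (H \<oplus> M) = \<P>"
    unfolding M_def using sep N assms
    by (subst funion_commute, intro outcome_plus_Game_mates_eq_P) (auto simp: is_option_def)
  moreover have "active M"
    by (simp add: M_def)
  ultimately show ?thesis
    by (auto simp: is_mate_def)
qed

lemma game_eq_imp_reversible:
  assumes "G \<doteq> H" "uncovered H' H G"
  shows "\<exists>H''. is_option H'' H' \<and> H'' \<doteq> G"
proof (rule ccontr)
  assume "\<not> ?thesis"
  moreover have H': "is_option H' H" and "\<And>G'. is_option G' G \<Longrightarrow> \<not> G' \<doteq> H'"
    using assms(2) by (auto simp: uncovered_def dest: game_eq_sym)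
  ultimately obtain M where M: "is_mate M G" "is_mate M H'"
    using ex_common_mate[of G H'] by blast
  have "outcome (H \<oplus> M) = \<N>"
    using H' M(2) by (rule outcome_plus_mate_of_option_eq_N)
  then show False
    using game_eq_imp_is_mate_iff[OF assms(1)] M(1) by (simp add: is_mate_def)
qed

lemma type_of_eq_iff:
  "type_of G = type_of H \<longleftrightarrow> (active G \<longleftrightarrow> active H) \<and>
     (active G \<longrightarrow> (\<exists>G'. is_option G' G \<and> \<not> active G') \<longleftrightarrow> (\<exists>H'. is_option H' H \<and> \<not> active H'))"
  by (auto simp: type_of_def)

lemma game_eq_imp_active:
  assumes "G \<doteq> H" "active G"
  shows "active H"
proof (rule ccontr)
  assume "\<not> active H"
  obtain M where M: "is_mate M G"
    using ex_mate by blast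
  have "outcome (G \<oplus> Game {|M|} False) = \<N>"
    using assms(2) M by (intro outcome_plus_eq_N_right[of G _ M]) (auto simp: is_mate_def)
  moreover have "outcome (H \<oplus> Game {|M|} False) = \<P>"
    using \<open>\<not> active H\<close> by (simp add: outcome_plus_inactive_eq_P)
  ultimately show False
    using assms(1) game_eq_outcome_plus by fastforce
qed

lemma game_eq_imp_inactive_option:
  assumes "G \<doteq> H" "active G" "is_option G' G" "\<not> active G'"
  shows "\<exists>H'. is_option H' H \<and> \<not> active H'"
proof (rule ccontr)
  assume all_active: "\<not> ?thesis"
  obtain m where m: "\<And>G. is_mate (m G) G"
    using ex_mate by metis
  define X where "X = Game (m |`| opts H |\<union>| {||}) False"
  have "outcome (H \<oplus> X) = \<P>"
    unfolding X_def using m all_active by (intro outcome_plus_Game_mates_eq_P) auto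
  moreover have "outcome (G' \<oplus> X) = \<P>"
    using assms(4) by (simp add: outcome_plus_inactive_eq_P X_def)
  then have "outcome (G \<oplus> X) = \<N>"
    using assms(2,3) outcome_plus_eq_N_left by blast
  ultimately show False
    using assms(1) game_eq_outcome_plus by fastforce
qed

lemma game_eq_imp_type_of_eq:
  assumes "G \<doteq> H"
  shows "type_of G = type_of H"
  using game_eq_imp_active game_eq_imp_inactive_option assms assms[THEN game_eq_sym]
  unfolding type_of_eq_iff by blast

lemma outcome_plus_eq_N_if_not_uncovered:
  assumes "\<not> uncovered G' G H" "is_option G' G" "outcome (G' \<oplus> X) = \<P>" "active H \<or> active X"
  shows "outcome (H \<oplus> X) = \<N>"
proof -
  obtain H' where "is_option H' H" "G' \<doteq> H'"
    using assms(1,2) by (auto simp: uncovered_def)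
  then show ?thesis
    using assms(3,4) game_eq_outcome_plus outcome_plus_eq_N_left by metis
qed

lemma outcome_plus_eq_N_if_reversible:
  assumes type: "type_of G = type_of H"
    and H': "is_option H' H" "outcome (H' \<oplus> X) = \<P>"
    and H'': "is_option H'' H'" "H'' \<doteq> G"
    and act: "active G \<or> active X"
  shows "outcome (G \<oplus> X) = \<N>"
proof (cases "active H' \<or> active X")
  case True
  then have "outcome (H'' \<oplus> X) = \<N>"
    using H'(2) H''(1) outcome_plus_eq_P_iff by blast
  then show ?thesis
    using game_eq_outcome_plus[OF H''(2)] by simp
next
  case False
  then obtain G' where G': "is_option G' G" "\<not> active G'"
    using type act H'(1) by (auto simp: type_of_eq_iff)
  then have "outcome (G' \<oplus> X) = \<P>"
    using False by (simp add: outcome_plus_inactive_eq_P)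
  then show ?thesis
    using act G'(1) by (intro outcome_plus_eq_N_left)
qed

lemma game_eq_if_reversible:
  assumes cov: "covered_by G H"
    and type: "type_of G = type_of H"
    and rev: "\<And>H'. uncovered H' H G \<Longrightarrow> \<exists>H''. is_option H'' H' \<and> H'' \<doteq> G"
  shows "G \<doteq> H"
proof -
  have act: "active G \<longleftrightarrow> active H"
    using type by (simp add: type_of_eq_iff)
  have G_move: "outcome (H \<oplus> X) = \<N>"
    if "active G \<or> active X" "is_option G' G" "outcome (G' \<oplus> X) = \<P>" for X G'
    using that cov act outcome_plus_eq_N_if_not_uncovered unfolding covered_by_def by blast
  have H_move: "outcome (G \<oplus> X) = \<N>"
    if "active G \<or> active X" "is_option H' H" "outcome (H' \<oplus> X) = \<P>" for X H'
    using that rev outcome_plus_eq_N_if_not_uncovered outcome_plus_eq_N_if_reversible[OF type]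
    by blast
  have "outcome (G \<oplus> X) = outcome (H \<oplus> X)" for X
  proof (induction X rule: game_option_induct)
    case (options X)
    show ?case
    proof (rule outcome_eqI)
      show "outcome (G \<oplus> X) = \<N> \<longleftrightarrow> outcome (H \<oplus> X) = \<N>"
        using act options G_move[of X] H_move[of X]
          outcome_plus_eq_N_iff[of G X] outcome_plus_eq_N_iff[of H X] by auto
    qed
  qed
  then show ?thesis
    by (simp add: game_eq_def)
qed

theorem theorem3p34:
  fixes G H :: game
  assumes "covered_by G H"
  shows "G \<doteq> H \<longleftrightarrow>
    type_of G = type_of H \<and>
    (\<forall>H'. uncovered H' H G \<longrightarrow> (\<exists>H''. is_option H'' H' \<and> H'' \<doteq> G))"
proof (intro iffI conjI allI impI)
  assume eq: "G \<doteq> H"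
  show "type_of G = type_of H"
    using eq by (rule game_eq_imp_type_of_eq)
  show "\<exists>H''. is_option H'' H' \<and> H'' \<doteq> G" if "uncovered H' H G" for H'
    using eq that by (rule game_eq_imp_reversible)
next
  assume "type_of G = type_of H \<and>
    (\<forall>H'. uncovered H' H G \<longrightarrow> (\<exists>H''. is_option H'' H' \<and> H'' \<doteq> G))"
  with assms show "G \<doteq> H"
    by (intro game_eq_if_reversible) auto
qed

end
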